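(* Let $p(z)=a_dz^d+\dots+a_1z+a_0\in\mathbb{Z}[z]$ with $d\ge 1$ and $a_d>0$ be such that $2\mid p(1)p(2)$. Then for every sufficiently large $N$ and every 2-colouring of $[N,N^{d^3+o(1)}]$, there is a monochromatic solution to $x+y=p(z)$; that is, for every $\varepsilon>0$ there is $N_0$ (depending only on $p$ and $\varepsilon$) such that for all integers $N\ge N_0$, every 2-colouring of the integers in $[N,N^{d^3+\varepsilon}]$ admits a monochromatic solution to $x+y=p(z)$ with $x,y,z\in[N,N^{d^3+\varepsilon}]$. Moreover, there exists some $c>0$ such that for all sufficiently large $N$ there is a 2-colouring of the integers in $[N,cN^{d^2}]$ without monochromatic solutions of $x+y=p(z)$ with $x,y,z\in [N,cN^{d^2}]$.
   Context: A 2-colouring of a set $S$ of positive integers is a function $\phi:S\to\{-1,1\}$. A monochromatic solution to $x+y=p(z)$ in $S$ is a triple $x,y,z\in S$ (not necessarily distinct) with $x+y=p(z)$ and $\phi(x)=\phi(y)=\phi(z)$. *)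

theory Defs
  imports Complex_Main "HOL-Library.FuncSet" "HOL-Computational_Algebra.Polynomial"
begin

(* The integers in the real interval [a, b], whose endpoints need not be integers. *)
definition int_interval :: "real \<Rightarrow> real \<Rightarrow> int set" where
  "int_interval a b = {n. a \<le> real_of_int n \<and> real_of_int n \<le> b}"

(* A colouring of S is a total function of which only the values on S matter. *)
definition two_colouring :: "int set \<Rightarrow> (int \<Rightarrow> int) \<Rightarrow> bool" where
  "two_colouring S \<phi> \<longleftrightarrow> \<phi> \<in> S \<rightarrow> {-1, 1}"

definition mono_solution ::
  "int poly \<Rightarrow> int set \<Rightarrow> (int \<Rightarrow> int) \<Rightarrow> int \<Rightarrow> int \<Rightarrow> int \<Rightarrow> bool" where
  "mono_solution p S \<phi> x y z \<longleftrightarrow>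
     x \<in> S \<and> y \<in> S \<and> z \<in> S \<and> x + y = poly p z \<and> \<phi> x = \<phi> y \<and> \<phi> y = \<phi> z"

end

theory Submission
  imports Defs
begin

text \<open>Write f for the polynomial p.  If k and k + 1 have different colours, then reflecting x first in
  f k and then in f (k + 1) shows that, below f k, the colour of k is preserved by the step
  D = f (k + 1) - f k; since one of f k, f (k + 1) is even, halving it gives a point h close to
  f k / 2 at which this preservation is strict: h and h + D have different colours.  Two such
  changes k < l in opposite directions with steps small compared to f k contradict each other,
  because combining the two steps would also preserve the colour going down from h + D to h.
  A change k of size O(N^d) exists, as z and f z / 2 differ in colour.  Below h the progression
  k + jD has the colour of k, so h - D, h, h + D essentially alternate in colour, which yields two
  opposite changes of comparable size O(N^(d^2)); values of f there are O(N^(d^3)).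

  For the lower bound, split the interval at N^d / 4.\<close>

section \<open>Colour changes, monotonicity and rotations on the integers\<close>

lemma int_change_point:
  fixes c :: "int \<Rightarrow> bool" and a b :: int
  assumes "a \<le> b" and "c a \<noteq> c b"
  shows "\<exists>k. a \<le> k \<and> k < b \<and> c k = c a \<and> c (k + 1) = (\<not> c a)"
  using assms
proof (induction b rule: int_ge_induct)
  case (step i)
  show ?case
  proof (cases "c i = c a")
    case True
    with step.prems step.hyps show ?thesis by (intro exI[of _ i]) auto
  next
    case False
    with step.IH obtain k where "a \<le> k" "k < i" "c k = c a" "c (k + 1) = (\<not> c a)" by blast
    then show ?thesis by (intro exI[of _ k]) auto
  qed
qed simp

lemma int_le_of_step_less:
  fixes f :: "int \<Rightarrow> 'a::order"
  assumes "\<And>z. N \<le> z \<Longrightarrow> f z < f (z + 1)" and "N \<le> z" "z \<le> w"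
  shows "f z \<le> f w"
  using assms(3)
proof (induction w rule: int_ge_induct)
  case (step i)
  then have "f i < f (i + 1)" using assms by simp
  with step.IH show ?case by order
qed simp

text \<open>On a window of length D + E the steps +D and -E together act as the rotation by D modulo
  D + E, which has finite order; hence closure under both steps entails closure under -D.\<close>

lemma rotation_closed_backward:
  fixes P :: "int \<Rightarrow> bool" and a D E :: int
  assumes "0 < D" "0 < E" and start: "P (a + D)"
    and up: "\<And>x. a \<le> x \<Longrightarrow> x < a + E \<Longrightarrow> P x \<Longrightarrow> P (x + D)"
    and down: "\<And>x. a + E \<le> x \<Longrightarrow> x < a + D + E \<Longrightarrow> P x \<Longrightarrow> P (x - E)"
  shows "P a"
proof -
  define m where "m = D + E"
  have m: "m > 0" using assms by (simp add: m_def)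
  have orbit: "P (a + (int (Suc n) * D) mod m)" for n
  proof (induction n)
    case 0
    show ?case using start assms by (simp add: m_def)
  next
    case (Suc n)
    define y where "y = (int (Suc n) * D) mod m"
    have y: "0 \<le> y" "y < m" using m by (auto simp: y_def)
    have next_eq: "(int (Suc (Suc n)) * D) mod m = (y + D) mod m"
      by (simp add: y_def mod_simps algebra_simps)
    show ?case
    proof (cases "y < E")
      case True
      then have "(y + D) mod m = y + D" using y assms by (simp add: m_def)
      then show ?thesis using up[of "a + y"] Suc True y next_eq by (simp add: y_def add.assoc)
    next
      case False
      have "(y + D) mod m = (y - E) mod m" by (simp add: m_def mod_eq_dvd_iff)
      also have "\<dots> = y - E" using False y assms by simp
      finally have "(y + D) mod m = y - E" .
      then show ?thesis using down[of "a + y"] Suc False y next_eq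
        by (simp add: y_def m_def add_diff_eq)
    qed
  qed
  \<comment> \<open>The orbit starts at \<open>D\<close>, where \<open>P\<close> is given, and its
    \<open>m\<close>-th point \<open>m * D mod m = 0\<close> is \<open>a\<close> itself.\<close>
  obtain n where n: "m = int (Suc n)"
    using m by (metis gr0_implies_Suc zero_less_imp_eq_int)
  then show ?thesis using orbit[of n] by simp
qed

section \<open>Colourings without monochromatic solutions, for an abstract function
  \<open>f\<close>\<close>

locale solution_free =
  fixes f :: "int \<Rightarrow> int" and N M :: int and c :: "int \<Rightarrow> bool"
  assumes free: "\<lbrakk>x \<in> {N..M}; y \<in> {N..M}; z \<in> {N..M}; x + y = f z; c x = c y\<rbrakk> \<Longrightarrow> c z \<noteq> c x"
begin

lemma reflect:
  assumes "x \<in> {N..M}" "z \<in> {N..M}" "f z - x \<in> {N..M}" "c x = c z"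
  shows "c (f z - x) = (\<not> c z)"
  using free[of x "f z - x" z] assms by auto

lemma half:
  assumes "x \<in> {N..M}" "z \<in> {N..M}" "2 * x = f z"
  shows "c x = (\<not> c z)"
  using free[of x x z] assms by auto

text \<open>Two reflections, in \<open>f k\<close> and then in \<open>f (k + 1)\<close>, compose to
  a translation. The bounds on \<open>x\<close> keep both images in the interval:
  \<open>f k - x\<close> is at least \<open>N\<close>, and the final point is at most
  \<open>f (k + 1) - N\<close>.\<close>

lemma shift_up:
  assumes "k \<in> {N..M}" "k + 1 \<in> {N..M}" "c (k + 1) = (\<not> c k)"
    and "f k \<le> f (k + 1)" "f (k + 1) \<le> M" "0 \<le> N" "N \<le> x" "x \<le> f k - N" "c x = c k"
  shows "c (x + (f (k + 1) - f k)) = c k"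
proof -
  have "c (f k - x) = c (k + 1)" using reflect[of x k] assms by auto
  then have "c (f (k + 1) - (f k - x)) = c k" using reflect[of "f k - x" "k + 1"] assms by auto
  then show ?thesis by (simp add: algebra_simps)
qed

text \<open>This provides a place where the converse of \<open>shift_up\<close> fails. Whichever of
  \<open>f k\<close> and \<open>f (k + 1)\<close> is even is halved, and one reflection supplies the
  other point of the pair; \<open>2 * h\<close> is \<open>f k\<close> or \<open>f k - D\<close>. The
  bounds on \<open>D\<close> and \<open>N\<close> keep both points in the interval.\<close>

lemma half_step:
  assumes k: "k \<in> {N..M}" "k + 1 \<in> {N..M}" "c (k + 1) = (\<not> c k)"
    and f: "f k \<le> f (k + 1)" "f (k + 1) \<le> M" and "0 \<le> N"
    and parity: "even (f k) \<or> even (f (k + 1))"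
    and D: "D = f (k + 1) - f k" "4 * D \<le> f k" "4 * N \<le> f k"
  obtains h where "f k \<le> 2 * h + D" "2 * h \<le> f k" "c h = (\<not> c k)" "c (h + D) = c k"
proof (cases "even (f k)")
  case True
  then obtain h where h: "f k = 2 * h" by (elim evenE)
  have hk: "c h = (\<not> c k)" using half[of h k] h assms by auto
  have "c (f (k + 1) - h) = c k" using reflect[of h "k + 1"] hk h assms by auto
  then show ?thesis using that[of h] hk h D f by (simp add: algebra_simps)
next
  case False
  then obtain x where x: "f (k + 1) = 2 * x" using parity by (elim disjE evenE) auto
  have xk: "c x = c k" using half[of x "k + 1"] x assms by auto
  have "c (f k - x) = (\<not> c k)" using reflect[of x k] xk x assms by auto
  moreover have "f k - x + D = x" using x D by simp
  ultimately show ?thesis using that[of "f k - x"] xk x D f by auto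
qed

text \<open>With D and E the increments of \<open>f\<close> at \<open>k\<close> and
  \<open>l\<close>, \<open>shift_up\<close> at \<open>k\<close> preserves the colour of
  \<open>k\<close> under +D. At \<open>l\<close> it preserves the other colour under +E, so by
  contraposition -E preserves the colour of \<open>k\<close>. The rotation argument then carries
  this colour from \<open>h + D\<close> back to \<open>h\<close>, against \<open>half_step\<close>.
  The factors 16 and 9 keep the window from \<open>h\<close> to \<open>h + D + E\<close> between
  \<open>N\<close> and \<open>f k - N\<close>.\<close>

lemma opposite_changes_absurd:
  assumes k: "k \<in> {N..M}" "k + 1 \<in> {N..M}" "c (k + 1) = (\<not> c k)"
    and l: "l \<in> {N..M}" "l + 1 \<in> {N..M}" "c l = (\<not> c k)" "c (l + 1) = c k"
    and f: "f k < f (k + 1)" "f k \<le> f l" "f l < f (l + 1)" "f (k + 1) \<le> M" "f (l + 1) \<le> M"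
    and parity: "even (f k) \<or> even (f (k + 1))"
    and small: "16 * (f (k + 1) - f k) \<le> f k" "16 * (f (l + 1) - f l) \<le> f k" "9 * N \<le> f k"
    and "0 < N"
  shows False
proof -
  define D where "D = f (k + 1) - f k"
  define E where "E = f (l + 1) - f l"
  have small': "16 * D \<le> f k" "16 * E \<le> f k" "0 < D" "0 < E"
    using small f by (auto simp: D_def E_def)
  obtain h where h: "f k \<le> 2 * h + D" "2 * h \<le> f k" "c h = (\<not> c k)" "c (h + D) = c k"
    using half_step[of k D] k f parity small small' \<open>0 < N\<close> by (auto simp: D_def)
  have hN: "N \<le> h" using h small' small by linarith
  have "c h = c k"
  proof (rule rotation_closed_backward[of D E "\<lambda>x. c x = c k" h])
    fix x assume x: "h \<le> x" "x < h + E" "c x = c k"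
    have "x \<le> f k - N" using x h small' small by linarith
    then show "c (x + D) = c k"
      using shift_up[of k x] k f x hN \<open>0 < N\<close> by (simp add: D_def)
  next
    fix x assume x: "h + E \<le> x" "x < h + D + E" "c x = c k"
    have "x - E \<le> f l - N" "N \<le> x - E" using x h small' small f hN by linarith+
    then have "c (x - E) = c l \<Longrightarrow> c (x - E + E) = c l"
      using shift_up[of l "x - E"] l f \<open>0 < N\<close> by (simp add: E_def)
    then show "c (x - E) = c k" using x l by auto
  qed (use h small' in auto)
  then show False using h by simp
qed

text \<open>A single change at \<open>k\<close> forces two opposite changes within a factor 8 of
  each other, both at most \<open>2 * f k\<close>; this is why \<open>M\<close> has to reach
  \<open>f (2 * f k + 1)\<close>.\<close>

lemma change_scale_absurd:
  assumes k: "100 * N \<le> k" "k \<le> M" "c (k + 1) = (\<not> c k)"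
    and "0 < N"
    and mono: "\<And>z. N \<le> z \<Longrightarrow> f z < f (z + 1)"
    and linear: "\<And>z. N \<le> z \<Longrightarrow> z \<le> 2 * f z"
    and slow: "\<And>z w. N \<le> z \<Longrightarrow> z \<le> w \<Longrightarrow> w \<le> 8 * z \<Longrightarrow> 16 * (f (w + 1) - f w) \<le> f z"
    and parity: "\<And>z. even (f z) \<or> even (f (z + 1))"
    and M: "2 * f k + 1 \<le> M" "f (2 * f k + 1) \<le> M"
  shows False
proof -
  have f_le: "f z \<le> f w" if "N \<le> z" "z \<le> w" for z w
    using int_le_of_step_less[of N f z w] mono that by blast
  have fM: "f z \<le> M" if "N \<le> z" "z \<le> 2 * f k + 1" for z
    using f_le[OF that] M by simp
  \<comment> \<open>The factor 18 turns into the required \<open>9 * N <= f k'\<close> through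
    \<open>linear\<close>, which loses a factor 2.\<close>
  have absurd: False
    if "18 * N \<le> k'" "k' < l'" "l' \<le> 8 * k'" "l' \<le> 2 * f k"
      "c (k' + 1) = (\<not> c k')" "c l' = (\<not> c k')" "c (l' + 1) = c k'" for k' l'
  proof (rule opposite_changes_absurd[of k' l'])
    show "9 * N \<le> f k'" using linear[of k'] that \<open>0 < N\<close> by linarith
  qed (use that M mono[of k'] mono[of l'] f_le[of k' l'] fM[of "k' + 1"] fM[of "l' + 1"]
        parity[of k'] slow[of k' k'] slow[of k' l'] \<open>0 < N\<close> in auto)
  define D where "D = f (k + 1) - f k"
  have fk: "k \<le> 2 * f k" using linear k \<open>0 < N\<close> by simp
  have D: "0 < D" "16 * D \<le> f k"
    using mono[of k] slow[of k k] k \<open>0 < N\<close> by (auto simp: D_def)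
  have k_in: "k \<in> {N..M}" "k + 1 \<in> {N..M}" "f k \<le> f (k + 1)" "f (k + 1) \<le> M"
    using k fk M mono[of k] fM[of "k + 1"] \<open>0 < N\<close> by auto
  obtain h where h: "f k \<le> 2 * h + D" "2 * h \<le> f k" "c h = (\<not> c k)" "c (h + D) = c k"
    using half_step[of k D] k_in k fk D parity[of k] \<open>0 < N\<close> by (auto simp: D_def)
  \<comment> \<open>Since \<open>16 * D <= f k\<close>, \<open>h - D\<close> is at least 13/32 of
    \<open>f k\<close>, hence at least 13/64 of \<open>k\<close>; the hypothesis
    \<open>100 * N <= k\<close> makes this exceed \<open>18 * N\<close>.\<close>
  have hN: "18 * N \<le> h - D" using h D fk k \<open>0 < N\<close> by linarith
  show False
  proof (cases "h \<le> k")
    \<comment> \<open>Here the colour must return to that of \<open>k\<close> somewhere between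
      \<open>h\<close> and \<open>k\<close>, and this change is opposite to the one at
      \<open>k\<close> itself.\<close>
    case True
    then obtain l where l: "h \<le> l" "l < k" "c l = (\<not> c k)" "c (l + 1) = c k"
      using int_change_point[of h k c] h by auto
    have "k \<le> 8 * l" using l h D fk by linarith
    then show False by (intro absurd[of l k]) (use l k fk hN D in auto)
  next
    case False
    \<comment> \<open>Repeated use of \<open>shift_up\<close> colours the whole progression up to
      \<open>h\<close> like \<open>k\<close>.\<close>
    have above: "c (k + int j * D) = c k" if "k + int j * D \<le> h" for j
      using that
    proof (induction j)
      case (Suc j)
      then have "k + int j * D \<le> h - D" by (simp add: algebra_simps)
      moreover from this have "k + int j * D \<le> f k - N" using hN h \<open>0 < N\<close> D by linarith
      moreover have "N \<le> k + int j * D" using k \<open>0 < N\<close> D by (simp add: add_increasing2)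
      ultimately show ?case
        using Suc.IH shift_up[of k "k + int j * D"] k_in k \<open>0 < N\<close> D
        by (simp add: D_def algebra_simps)
    qed simp
    \<comment> \<open>The last term of the progression not exceeding \<open>h\<close>, so less than
      \<open>D\<close> below it. The colours at \<alpha>, \<open>h\<close>, \<open>h + D\<close>
      alternate, giving a change on either side of \<open>h\<close>.\<close>
    define \<alpha> where "\<alpha> = k + (h - k) div D * D"
    have "\<alpha> = h - (h - k) mod D" by (simp add: \<alpha>_def minus_div_mult_eq_mod[symmetric])
    then have \<alpha>: "\<alpha> \<le> h" "h - D < \<alpha>" using D by auto
    have "0 \<le> (h - k) div D" using False D by (simp add: pos_imp_zdiv_nonneg_iff)
    then have "c \<alpha> = c k" using above[of "nat ((h - k) div D)"] \<alpha> by (simp add: \<alpha>_def)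
    then obtain k' where k': "\<alpha> \<le> k'" "k' < h" "c k' = c k" "c (k' + 1) = (\<not> c k)"
      using int_change_point[of \<alpha> h c] h \<alpha> by auto
    obtain l' where l': "h \<le> l'" "l' < h + D" "c l' = (\<not> c k)" "c (l' + 1) = c k"
      using int_change_point[of h "h + D" c] h D by auto
    have "l' \<le> 8 * k'" "l' \<le> 2 * f k" using k' l' \<alpha> h D by linarith+
    then show False by (intro absurd[of k' l']) (use k' l' \<alpha> hN in auto)
  qed
qed

end

text \<open>The first change lies below \<open>R = 2 * f (400 * N + 1)\<close>, and
  \<open>change_scale_absurd\<close> at a change \<open>k\<close> needs \<open>M\<close> to reach
  \<open>f (2 * f k + 1)\<close>. Hence \<open>f\<close> is nested three times, which produces the
  exponent d^3.\<close>

lemma monochromatic_solution_exists: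
  fixes f :: "int \<Rightarrow> int" and N M :: int and c :: "int \<Rightarrow> bool"
  assumes "0 < N"
    and mono: "\<And>z. N \<le> z \<Longrightarrow> f z < f (z + 1)"
    and linear: "\<And>z. N \<le> z \<Longrightarrow> z \<le> 2 * f z"
    and slow: "\<And>z w. N \<le> z \<Longrightarrow> z \<le> w \<Longrightarrow> w \<le> 8 * z \<Longrightarrow> 16 * (f (w + 1) - f w) \<le> f z"
    and parity: "\<And>z. even (f z) \<or> even (f (z + 1))"
    and M: "2 * f (2 * f (400 * N + 1)) + 1 \<le> M" "f (2 * f (2 * f (400 * N + 1)) + 1) \<le> M"
  shows "\<exists>x y z. x \<in> {N..M} \<and> y \<in> {N..M} \<and> z \<in> {N..M} \<and> x + y = f z \<and> c x = c y \<and> c y = c z"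
proof (rule ccontr)
  assume "\<not> ?thesis"
  then interpret solution_free f N M c by unfold_locales blast
  have f_le: "f z \<le> f w" if "N \<le> z" "z \<le> w" for z w
    using int_le_of_step_less[of N f z w] mono that by blast
  \<comment> \<open>With \<open>q\<close> half of \<open>f z\<close>, the bound
    \<open>z <= 2 * f z\<close> gives \<open>q >= z / 4\<close>, so the factor 400 leaves the
    \<open>100 * N\<close> needed at the change.\<close>
  obtain z where z: "400 * N \<le> z" "z \<le> 400 * N + 1" "even (f z)"
    using parity[of "400 * N"] that[of "400 * N"] that[of "400 * N + 1"] by auto
  then obtain q where q: "f z = 2 * q" by (elim evenE) auto
  define R where "R = 2 * f (400 * N + 1)"
  have zR: "z \<le> R" "q \<le> R" "R \<le> 2 * f R" "100 * N \<le> q"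
    using f_le[of z "400 * N + 1"] linear[of z] linear[of R] z q \<open>0 < N\<close> by (auto simp: R_def)
  have "c q = (\<not> c z)"
    using half[of q z] zR q z M \<open>0 < N\<close> by (auto simp: R_def)
  \<comment> \<open>The order of \<open>q\<close> and \<open>z\<close> is not known, for instance
    when \<open>f\<close> is linear.\<close>
  then have "c (min q z) \<noteq> c (max q z)" by (auto simp: min_def max_def)
  then obtain k where k: "min q z \<le> k" "k < max q z" "c (k + 1) = (\<not> c k)"
    using int_change_point[of "min q z" "max q z" c] by (auto simp: min_le_iff_disj)
  have kR: "100 * N \<le> k" "k \<le> R" using k zR z \<open>0 < N\<close> by (auto simp: min_def max_def split: if_splits)
  have "f k \<le> f R" "k \<le> 2 * f k" using f_le[of k R] linear[of k] kR \<open>0 < N\<close> by auto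
  then have "2 * f k + 1 \<le> M" "f (2 * f k + 1) \<le> M"
    using f_le[of "2 * f k + 1" "2 * f R + 1"] M kR \<open>0 < N\<close> by (auto simp: R_def)
  then show False
    using change_scale_absurd[of k] k kR assms(1) mono linear slow parity \<open>k \<le> 2 * f k\<close> by auto
qed

section \<open>Growth and parity of integer polynomials\<close>

lemma abs_poly_le_power:
  fixes q :: "'a::linordered_idom poly"
  shows "\<exists>C\<ge>0. \<forall>x\<ge>1. \<bar>poly q x\<bar> \<le> C * x ^ degree q"
proof (intro exI conjI allI impI)
  show "(\<Sum>i\<le>degree q. \<bar>coeff q i\<bar>) \<ge> 0" by (simp add: sum_nonneg)
  fix x :: 'a assume x: "1 \<le> x"
  have "\<bar>poly q x\<bar> \<le> (\<Sum>i\<le>degree q. \<bar>coeff q i * x ^ i\<bar>)"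
    unfolding poly_altdef by (rule sum_abs)
  also have "\<dots> \<le> (\<Sum>i\<le>degree q. \<bar>coeff q i\<bar> * x ^ degree q)"
    using x by (intro sum_mono) (auto simp: abs_mult intro!: mult_left_mono power_increasing)
  finally show "\<bar>poly q x\<bar> \<le> (\<Sum>i\<le>degree q. \<bar>coeff q i\<bar>) * x ^ degree q"
    by (simp add: sum_distrib_right)
qed

text \<open>A positive integer leading coefficient is at least 1, and once \<open>x\<close> exceeds
  twice the sum of the other absolute coefficients, the lower terms cost at most half of the leading
  power.\<close>

lemma power_le_twice_poly:
  fixes p :: "int poly"
  assumes "degree p \<ge> 1" and "lead_coeff p > 0"
  shows "\<exists>B\<ge>1. \<forall>x\<ge>B. x ^ degree p \<le> 2 * poly p x"
proof -
  obtain e where e: "degree p = Suc e" using assms by (cases "degree p") auto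
  define C where "C = (\<Sum>i\<le>e. \<bar>coeff p i\<bar>)"
  have C: "C \<ge> 0" by (simp add: C_def sum_nonneg)
  have "x ^ degree p \<le> 2 * poly p x" if x: "2 * C + 1 \<le> x" for x :: int
  proof -
    have x1: "1 \<le> x" using x C by linarith
    have "\<bar>\<Sum>i\<le>e. coeff p i * x ^ i\<bar> \<le> (\<Sum>i\<le>e. \<bar>coeff p i * x ^ i\<bar>)" by (rule sum_abs)
    also have "\<dots> \<le> (\<Sum>i\<le>e. \<bar>coeff p i\<bar> * x ^ e)"
      using x1 by (intro sum_mono) (auto simp: abs_mult intro!: mult_left_mono power_increasing)
    finally have low: "\<bar>\<Sum>i\<le>e. coeff p i * x ^ i\<bar> \<le> C * x ^ e"
      by (simp add: C_def sum_distrib_right)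
    have "(2 * C) * x ^ e \<le> x * x ^ e" using x x1 by (intro mult_right_mono) auto
    moreover have "x ^ Suc e \<le> coeff p (Suc e) * x ^ Suc e"
      using mult_right_mono[of 1 "coeff p (Suc e)" "x ^ Suc e"] assms x1 by (simp add: e)
    moreover have "poly p x = (\<Sum>i\<le>e. coeff p i * x ^ i) + coeff p (Suc e) * x ^ Suc e"
      by (simp add: poly_altdef e)
    ultimately show ?thesis using low by (simp add: e)
  qed
  then show ?thesis using C by (intro exI[of _ "2 * C + 1"]) auto
qed

lemma poly_of_int_poly:
  "poly (map_poly real_of_int p) (real_of_int x) = real_of_int (poly p x)"
  by (induction p) (auto simp: map_poly_pCons)

text \<open>By the mean value theorem the increment is a value of the derivative, which has degree
  \<open>e\<close> and a positive leading coefficient.\<close>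

lemma poly_difference_bounds:
  fixes p :: "int poly"
  assumes "degree p = Suc e" and "lead_coeff p > 0"
  shows "\<exists>B C. \<forall>x\<ge>B. 0 < poly p (x + 1) - poly p x \<and> poly p (x + 1) - poly p x \<le> C * x ^ e"
proof -
  define P where "P = map_poly real_of_int p"
  have deg: "degree P = Suc e" using assms by (simp add: P_def degree_map_poly)
  have "lead_coeff P > 0" using assms by (simp add: P_def degree_map_poly coeff_map_poly)
  then have lc: "lead_coeff (pderiv P) > 0"
    by (simp add: degree_pderiv coeff_pderiv deg)
  then obtain n where n: "\<And>x. x \<ge> n \<Longrightarrow> poly (pderiv P) x \<ge> lead_coeff (pderiv P)"
    using poly_pinfty_gt_lc by blast
  obtain C where C: "C \<ge> 0" "\<And>x. x \<ge> 1 \<Longrightarrow> \<bar>poly (pderiv P) x\<bar> \<le> C * x ^ e"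
    using abs_poly_le_power[of "pderiv P"] by (auto simp: degree_pderiv deg)
  \<comment> \<open>The factor \<open>2 ^ e\<close> comes from bounding the intermediate point by
    \<open>x + 1 <= 2 * x\<close>; the ceiling makes the constant an integer.\<close>
  have "0 < poly p (x + 1) - poly p x \<and> poly p (x + 1) - poly p x \<le> \<lceil>C * 2 ^ e\<rceil> * x ^ e"
    if x: "max 1 \<lceil>n\<rceil> \<le> x" for x
  proof -
    obtain \<xi> where \<xi>: "real_of_int x < \<xi>" "\<xi> < real_of_int x + 1"
      "real_of_int (poly p (x + 1) - poly p x) = poly (pderiv P) \<xi>"
      using poly_MVT[of "real_of_int x" "real_of_int x + 1" P]
        poly_of_int_poly[of p "x + 1"] poly_of_int_poly[of p x] by (auto simp: P_def)
    have \<xi>1: "\<xi> \<ge> n" "\<xi> \<ge> 1" "\<xi> \<le> 2 * real_of_int x" using x \<xi> by linarith+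
    have "C * \<xi> ^ e \<le> C * (2 * real_of_int x) ^ e"
      using \<xi>1 C by (intro mult_left_mono power_mono) auto
    also have "\<dots> = (C * 2 ^ e) * real_of_int x ^ e" by (simp add: power_mult_distrib)
    also have "\<dots> \<le> real_of_int \<lceil>C * 2 ^ e\<rceil> * real_of_int x ^ e"
      using x by (intro mult_right_mono) auto
    also have "\<dots> = real_of_int (\<lceil>C * 2 ^ e\<rceil> * x ^ e)" by simp
    finally have "real_of_int (poly p (x + 1) - poly p x) \<le> real_of_int (\<lceil>C * 2 ^ e\<rceil> * x ^ e)"
      using C(2)[of \<xi>] \<xi> \<xi>1 by linarith
    moreover have "0 < real_of_int (poly p (x + 1) - poly p x)" using n[of \<xi>] \<xi> \<xi>1 lc by linarith
    ultimately show ?thesis by (simp only: of_int_le_iff of_int_0_less_iff)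
  qed
  then show ?thesis by blast
qed

lemma poly_increments_small:
  fixes p :: "int poly"
  assumes "degree p \<ge> 1" and "lead_coeff p > 0"
  shows "\<exists>B\<ge>1. \<forall>z\<ge>B. poly p z < poly p (z + 1) \<and> z \<le> 2 * poly p z \<and>
    (\<forall>w. z \<le> w \<longrightarrow> w \<le> 8 * z \<longrightarrow> 16 * (poly p (w + 1) - poly p w) \<le> poly p z)"
proof -
  obtain e where e: "degree p = Suc e" using assms by (cases "degree p") auto
  obtain B where B: "B \<ge> 1" "\<And>x. B \<le> x \<Longrightarrow> x ^ Suc e \<le> 2 * poly p x"
    using power_le_twice_poly[OF assms] by (auto simp: e)
  obtain B' C where C: "\<And>x. B' \<le> x \<Longrightarrow> 0 < poly p (x + 1) - poly p x"
    "\<And>x. B' \<le> x \<Longrightarrow> poly p (x + 1) - poly p x \<le> C * x ^ e"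
    using poly_difference_bounds[OF e assms(2)] by blast
  \<comment> \<open>Here 32 is 16 times the 2 lost in \<open>z ^ Suc e <= 2 * poly p z\<close>, and
    \<open>8 ^ e\<close> accounts for \<open>w <= 8 * z\<close>. Beyond \<open>K\<close> the extra
    factor \<open>z\<close> in \<open>poly p z\<close> absorbs all constants.\<close>
  define K where "K = 32 * (\<bar>C\<bar> * 8 ^ e)"
  show ?thesis
  proof (intro exI[of _ "max B (max B' K)"] conjI allI impI)
    fix z assume z: "max B (max B' K) \<le> z"
    then have z1: "1 \<le> z" using B by simp
    show "poly p z < poly p (z + 1)" using C(1)[of z] z by simp
    have "z \<le> z ^ Suc e" using z1 self_le_power[of z "Suc e"] by simp
    then show "z \<le> 2 * poly p z" using B(2)[of z] z by simp
    fix w assume w: "z \<le> w" "w \<le> 8 * z"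
    have "C * w ^ e \<le> \<bar>C\<bar> * (8 * z) ^ e"
      using w z1 by (intro mult_mono power_mono) auto
    then have "32 * (poly p (w + 1) - poly p w) \<le> K * z ^ e"
      using C(2)[of w] w z by (simp add: K_def power_mult_distrib)
    also have "\<dots> \<le> z * z ^ e" using z z1 by (intro mult_right_mono) auto
    also have "\<dots> \<le> 2 * poly p z" using B(2)[of z] z by simp
    finally show "16 * (poly p (w + 1) - poly p w) \<le> poly p z" by simp
  qed (use B in auto)
qed

lemma even_poly_iff:
  fixes p :: "int poly"
  assumes "even (x - y)"
  shows "even (poly p x) \<longleftrightarrow> even (poly p y)"
  using assms by (induction p) auto

lemma even_poly_consecutive:
  fixes p :: "int poly"
  assumes "2 dvd poly p 1 * poly p 2"
  shows "even (poly p z) \<or> even (poly p (z + 1))"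
proof (cases "even z")
  case True
  then have "even (poly p z) = even (poly p 2)" "even (poly p (z + 1)) = even (poly p 1)"
    by (auto intro!: even_poly_iff)
  then show ?thesis using assms by auto
next
  case False
  then have "even (poly p z) = even (poly p 1)" "even (poly p (z + 1)) = even (poly p 2)"
    by (auto intro!: even_poly_iff)
  then show ?thesis using assms by auto
qed

lemma poly_eventually_le_powr:
  fixes q :: "int poly"
  assumes "degree q \<le> n" and "\<epsilon> > 0"
  shows "\<exists>B\<ge>1. \<forall>x\<ge>B. real_of_int (poly q x) \<le> real_of_int x powr (real n + \<epsilon>)"
proof -
  obtain C where C: "C \<ge> 0" "\<And>x. 1 \<le> x \<Longrightarrow> \<bar>poly q x\<bar> \<le> C * x ^ degree q"
    using abs_poly_le_power[of q] by auto
  show ?thesis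
  \<comment> \<open>From this threshold on, \<open>x powr\<close> \<epsilon> is at least
    \<open>C\<close>, so the constant is absorbed into the exponent.\<close>
  proof (intro exI[of _ "max 1 \<lceil>real_of_int C powr (1 / \<epsilon>)\<rceil>"] conjI allI impI)
    fix x assume x: "max 1 \<lceil>real_of_int C powr (1 / \<epsilon>)\<rceil> \<le> x"
    then have x1: "1 \<le> x" "real_of_int C powr (1 / \<epsilon>) \<le> real_of_int x" by linarith+
    have "(real_of_int C powr (1 / \<epsilon>)) powr \<epsilon> \<le> real_of_int x powr \<epsilon>"
      using x1 assms by (intro powr_mono2) auto
    then have Cx: "real_of_int C \<le> real_of_int x powr \<epsilon>"
      using C assms by (simp add: powr_powr)
    have "poly q x \<le> C * x ^ degree q" using C(2)[of x] x1 by simp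
    also have "\<dots> \<le> C * x ^ n" using x1 C assms by (intro mult_left_mono power_increasing) auto
    finally have "real_of_int (poly q x) \<le> real_of_int (C * x ^ n)" by (simp only: of_int_le_iff)
    also have "\<dots> \<le> real_of_int x powr \<epsilon> * real_of_int x ^ n"
      using Cx x1 by (simp add: mult_right_mono)
    also have "\<dots> = real_of_int x powr (real n + \<epsilon>)"
      using x1 by (simp add: powr_add powr_realpow mult.commute)
    finally show "real_of_int (poly q x) \<le> real_of_int x powr (real n + \<epsilon>)" .
  qed auto
qed

section \<open>The upper and lower bounds for polynomials\<close>

lemma int_interval_of_int: "int_interval (real_of_int N) b = {N..\<lfloor>b\<rfloor>}"
  by (auto simp: int_interval_def le_floor_iff)

lemma mono_solution_upper:
  fixes p :: "int poly" and \<epsilon> :: real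
  assumes d: "degree p \<ge> 1" "lead_coeff p > 0"
    and even: "2 dvd poly p 1 * poly p 2" and "\<epsilon> > 0"
  shows "\<exists>N0>0. \<forall>N\<ge>N0. \<forall>\<phi>.
    two_colouring (int_interval (real_of_int N) (real_of_int N powr (real (degree p ^ 3) + \<epsilon>))) \<phi> \<longrightarrow>
    (\<exists>x y z. mono_solution p
      (int_interval (real_of_int N) (real_of_int N powr (real (degree p ^ 3) + \<epsilon>))) \<phi> x y z)"
proof -
  \<comment> \<open>The two quantities that \<open>M\<close> must dominate, written as polynomials
    in \<open>N\<close> so that their degrees d^2 and d^3 can be read off from composition.\<close>
  define q1 where "q1 = [:1, 2:] \<circ>\<^sub>p (p \<circ>\<^sub>p ([:0, 2:] \<circ>\<^sub>p (p \<circ>\<^sub>p [:1, 400:])))"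
  define q2 where "q2 = p \<circ>\<^sub>p q1"
  have q1: "poly q1 N = 2 * poly p (2 * poly p (400 * N + 1)) + 1" for N
    by (simp add: q1_def poly_pcompose algebra_simps)
  have q2: "poly q2 N = poly p (2 * poly p (2 * poly p (400 * N + 1)) + 1)" for N
    unfolding q2_def poly_pcompose q1 ..
  have deg: "degree q1 = degree p ^ 2" "degree q2 = degree p ^ 3"
    by (simp_all add: q1_def q2_def degree_pcompose power2_eq_square power3_eq_cube)
  then have deg_le: "degree q1 \<le> degree p ^ 3" using d by (simp add: power_increasing)
  obtain B where B: "B \<ge> 1" "\<And>z. B \<le> z \<Longrightarrow> poly p z < poly p (z + 1)"
    "\<And>z. B \<le> z \<Longrightarrow> z \<le> 2 * poly p z"
    "\<And>z w. B \<le> z \<Longrightarrow> z \<le> w \<Longrightarrow> w \<le> 8 * z \<Longrightarrow> 16 * (poly p (w + 1) - poly p w) \<le> poly p z"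
    using poly_increments_small[OF d] by blast
  obtain B1 where B1: "\<And>N. B1 \<le> N \<Longrightarrow>
      real_of_int (poly q1 N) \<le> real_of_int N powr (real (degree p ^ 3) + \<epsilon>)"
    using poly_eventually_le_powr[OF deg_le \<open>\<epsilon> > 0\<close>] by blast
  obtain B2 where B2: "\<And>N. B2 \<le> N \<Longrightarrow>
      real_of_int (poly q2 N) \<le> real_of_int N powr (real (degree p ^ 3) + \<epsilon>)"
    using poly_eventually_le_powr[OF eq_refl[OF deg(2)] \<open>\<epsilon> > 0\<close>] by blast
  show ?thesis
  proof (rule exI[of _ "max B (max B1 B2)"], intro conjI allI impI)
    fix N \<phi>
    define M where "M = \<lfloor>real_of_int N powr (real (degree p ^ 3) + \<epsilon>)\<rfloor>"
    let ?I = "int_interval (real_of_int N) (real_of_int N powr (real (degree p ^ 3) + \<epsilon>))"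
    have I: "?I = {N..M}" unfolding M_def by (rule int_interval_of_int)
    assume N: "max B (max B1 B2) \<le> N" and col: "two_colouring ?I \<phi>"
    have "\<exists>x y z. x \<in> {N..M} \<and> y \<in> {N..M} \<and> z \<in> {N..M} \<and> x + y = poly p z \<and>
        (\<phi> x = 1) = (\<phi> y = 1) \<and> (\<phi> y = 1) = (\<phi> z = 1)"
    proof (rule monochromatic_solution_exists)
      show "2 * poly p (2 * poly p (400 * N + 1)) + 1 \<le> M"
        using B1[of N] N unfolding q1 M_def by (simp add: le_floor_iff)
      show "poly p (2 * poly p (2 * poly p (400 * N + 1)) + 1) \<le> M"
        using B2[of N] N unfolding q2 M_def by (simp add: le_floor_iff)
    qed (use N B even_poly_consecutive[OF even] in auto)
    then obtain x y z where xyz: "x \<in> ?I" "y \<in> ?I" "z \<in> ?I" "x + y = poly p z"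
      "(\<phi> x = 1) = (\<phi> y = 1)" "(\<phi> y = 1) = (\<phi> z = 1)" unfolding I by blast
    have "\<phi> t = 1 \<or> \<phi> t = -1" if "t \<in> ?I" for t
      using col that unfolding two_colouring_def Pi_def by auto
    then have "mono_solution p ?I \<phi> x y z"
      unfolding mono_solution_def using xyz by metis
    then show "\<exists>x y z. mono_solution p ?I \<phi> x y z" by blast
  qed (use B in auto)
qed

text \<open>Colour 1 is given to the integers below N^d/4. Two of them sum to less than N^d/2, which
  is at most \<open>poly p z\<close> for every \<open>z >= N\<close>. In the other colour
  \<open>z >= N^d/4\<close> forces \<open>x + y >= N^(d^2) / (2 * 4^d)\<close>, while the choice of
  \<open>c\<close> allows only half as much.\<close>

lemma mono_solution_lower:
  fixes p :: "int poly"
  assumes d: "degree p \<ge> 1" "lead_coeff p > 0"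
  defines "c \<equiv> 1 / (8 * 4 ^ degree p) :: real"
  shows "\<exists>N0>0. \<forall>N\<ge>N0. \<exists>\<phi>.
    two_colouring (int_interval (real_of_int N) (c * real_of_int N ^ (degree p ^ 2))) \<phi> \<and>
    \<not> (\<exists>x y z. mono_solution p
      (int_interval (real_of_int N) (c * real_of_int N ^ (degree p ^ 2))) \<phi> x y z)"
proof -
  define d where "d = degree p"
  obtain B where B: "B \<ge> 1" "\<And>x. B \<le> x \<Longrightarrow> x ^ d \<le> 2 * poly p x"
    using power_le_twice_poly[OF d] unfolding d_def by blast
  show ?thesis unfolding d_def[symmetric]
  proof (intro exI[of _ B] conjI allI impI)
    fix N assume N: "B \<le> N"
    let ?I = "int_interval (real_of_int N) (c * real_of_int N ^ (d ^ 2))"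
    define \<phi> where "\<phi> n = (if 4 * n < N ^ d then 1 else -1 :: int)" for n :: int
    have "\<not> mono_solution p ?I \<phi> x y z" for x y z
    proof
      assume "mono_solution p ?I \<phi> x y z"
      then have I: "N \<le> z" and xy: "x + y = poly p z" "\<phi> x = \<phi> y" "\<phi> y = \<phi> z"
        and le: "real_of_int x \<le> c * real_of_int N ^ (d ^ 2)"
          "real_of_int y \<le> c * real_of_int N ^ (d ^ 2)"
        unfolding mono_solution_def int_interval_def by auto
      have pz: "z ^ d \<le> 2 * (x + y)" using B(2)[of z] N I xy by simp
      show False
      proof (cases "\<phi> z = 1")
        case True
        then have "4 * x < N ^ d" "4 * y < N ^ d"
          using xy by (auto simp: \<phi>_def split: if_splits)
        moreover have "N ^ d \<le> z ^ d" using I N B by (intro power_mono) auto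
        ultimately have "4 * x + 4 * y < 2 * (2 * (x + y))" using pz by linarith
        then show False by simp
      next
        case False
        then have "N ^ d \<le> 4 * z" by (auto simp: \<phi>_def split: if_splits)
        then have "(N ^ d) ^ d \<le> (4 * z) ^ d" using N B by (intro power_mono) auto
        also have "\<dots> = 4 ^ d * z ^ d" by (simp add: power_mult_distrib)
        also have "\<dots> \<le> 4 ^ d * (2 * (x + y))" using pz by (intro mult_left_mono) auto
        finally have "N ^ (d ^ 2) \<le> 4 ^ d * (2 * (x + y))"
          by (simp add: power_mult[symmetric] power2_eq_square)
        then have "real_of_int (N ^ (d ^ 2)) \<le> real_of_int (4 ^ d * (2 * (x + y)))"
          by (simp only: of_int_le_iff)
        then have "real_of_int N ^ (d ^ 2) \<le> 4 ^ d * 2 * (real_of_int x + real_of_int y)"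
          by (simp add: algebra_simps)
        also have "\<dots> \<le> 4 ^ d * 2 * (2 * (c * real_of_int N ^ (d ^ 2)))"
          using le by (intro mult_left_mono) auto
        also have "\<dots> = real_of_int N ^ (d ^ 2) / 2" by (simp add: c_def d_def)
        finally have "real_of_int N ^ (d ^ 2) \<le> 0" by simp
        moreover have "real_of_int N ^ (d ^ 2) > 0" using N B by simp
        ultimately show False by simp
      qed
    qed
    moreover have "two_colouring ?I \<phi>" by (auto simp: two_colouring_def \<phi>_def)
    ultimately show "\<exists>\<phi>. two_colouring ?I \<phi> \<and> \<not> (\<exists>x y z. mono_solution p ?I \<phi> x y z)"
      by blast
  qed (use B in auto)
qed

theorem theorem5p1:
  fixes p :: "int poly" and d :: nat
  assumes "d = degree p"
    and "d \<ge> 1"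
    and "lead_coeff p > 0"
    and "2 dvd poly p 1 * poly p 2"
  shows "(\<forall>\<epsilon>::real. \<epsilon> > 0 \<longrightarrow>
            (\<exists>N0::int. N0 > 0 \<and> (\<forall>N\<ge>N0. \<forall>\<phi>.
               two_colouring (int_interval (real_of_int N) (real_of_int N powr (real (d ^ 3) + \<epsilon>))) \<phi> \<longrightarrow>
               (\<exists>x y z. mono_solution p
                  (int_interval (real_of_int N) (real_of_int N powr (real (d ^ 3) + \<epsilon>))) \<phi> x y z))))
       \<and> (\<exists>c::real. c > 0 \<and>
            (\<exists>N0::int. N0 > 0 \<and> (\<forall>N\<ge>N0. \<exists>\<phi>.
               two_colouring (int_interval (real_of_int N) (c * real_of_int N ^ (d ^ 2))) \<phi> \<and>
               \<not> (\<exists>x y z. mono_solution p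
                  (int_interval (real_of_int N) (c * real_of_int N ^ (d ^ 2))) \<phi> x y z))))"
proof -
  have p: "degree p \<ge> 1" "lead_coeff p > 0" using assms by auto
  have "(0::real) < 1 / (8 * 4 ^ degree p)" by simp
  then show ?thesis
    unfolding assms(1)
    using mono_solution_upper[OF p assms(4)] mono_solution_lower[OF p] by blast
qed

end
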